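(* For all integers $n \geq 1$, either $X(Y(n)) = X(n) + Y(n)$ or $X(Y(n)) = X(n) + Y(n) - 1$.
   Context: The sequences $(X(n))_{n\ge 0}$ and $(Y(n))_{n\ge 0}$ of non-negative integers (OEIS A140100 and A140101) are defined recursively as follows. Start with $X(0)=0$, $Y(0)=0$, $X(1)=1$, $Y(1)=2$. For $n>1$, choose the least positive integers $Y(n)>X(n)$ such that neither $Y(n)$ nor $X(n)$ appears in $\{Y(k) : 1\le k<n\}$ or $\{X(k): 1\le k<n\}$, and such that $Y(n)-X(n)$ does not appear in $\{Y(k)-X(k): 1\le k<n\}$ or $\{Y(k)+X(k): 1\le k<n\}$. Here "least" means: call $(n,x,y)$ good if $y>x$ are positive integers satisfying all of these conditions with $(x,y)$ in place of $(X(n),Y(n))$; then $X(n)$ is the least $x$ such that $(n,x,y)$ is good for some $y$, and $Y(n)$ is the least $y$ such that $(n,X(n),y)$ is good. First values for $n=0,1,2,\ldots$: $X = 0,1,3,4,6,7,9,10,12,14,15,\ldots$ and $Y = 0,2,5,8,11,13,16,19,22,25,28,\ldots$. *)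

theory Defs
  imports Main
begin

text \<open>The set \<open>P\<close> holds the pairs \<open>(X k, Y k)\<close> for \<open>1 \<le> k < n\<close>. Differences are taken in
  \<^typ>\<open>int\<close>, so that no truncated subtraction occurs.\<close>

definition good :: "(nat \<times> nat) set \<Rightarrow> nat \<Rightarrow> nat \<Rightarrow> bool" where
  "good P x y \<longleftrightarrow>
     0 < x \<and> x < y \<and>
     x \<notin> fst ` P \<and> x \<notin> snd ` P \<and>
     y \<notin> fst ` P \<and> y \<notin> snd ` P \<and>
     int y - int x \<notin> (\<lambda>(a, b). int b - int a) ` P \<and>
     int y - int x \<notin> (\<lambda>(a, b). int b + int a) ` P"

fun XY :: "nat \<Rightarrow> nat \<times> nat" where
  "XY 0 = (0, 0)"
| "XY (Suc 0) = (1, 2)"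
| "XY (Suc (Suc m)) =
     (let P = XY ` {1..<Suc (Suc m)};
          x = (LEAST x. \<exists>y. good P x y)
      in (x, LEAST y. good P x y))"

definition X :: "nat \<Rightarrow> nat" where
  "X n = fst (XY n)"

definition Y :: "nat \<Rightarrow> nat" where
  "Y n = snd (XY n)"

end

theory Submission
  imports Defs "HOL-Library.Sublist" "HOL-Library.Multiset"
begin

text \<open>
  Let \<open>T\<close> be the Tribonacci word, fixed by \<open>A \<mapsto> AB, B \<mapsto> AC, C \<mapsto> A\<close>. Then \<open>X (k + 1)\<close> exceeds
  \<open>k + 1\<close> by the number of letters \<open>A\<close> among the first \<open>k\<close> letters of \<open>T\<close>, and likewise \<open>Y - X\<close> with
  the letter \<open>B\<close>. The skipped values of these two sequences are exactly the values of \<open>Y\<close> and of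
  \<open>X + Y\<close>, because every letter of \<open>T\<close> has an image that contains \<open>A\<close> exactly once, at the front, and
  an image under the squared substitution that contains \<open>B\<close> exactly once, in second place.
  Hence both greedy minima are attained by these formulas.

  The claim says that the prefix of \<open>T\<close> of length \<open>Y (k + 1) - 1\<close> has as many letters \<open>A\<close> as
  \<open>\<phi>(w) w\<close>, or one more, where \<open>w\<close> is the prefix of length \<open>k\<close>. In fact it is an anagram of
  \<open>\<phi>(w) w\<close> with one extra letter, which follows by induction along \<open>\<phi>\<close> from a
  closed set of 16 local configurations.
\<close>

section \<open>The Tribonacci word\<close>

datatype letter = A | B | C

fun phi :: "letter \<Rightarrow> letter list" where
  "phi A = [A, B]"
| "phi B = [A, C]"
| "phi C = [A]"

definition subst :: "letter list \<Rightarrow> letter list" where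
  "subst w = concat (map phi w)"

definition trib :: "nat \<Rightarrow> letter list" where
  "trib n = (subst ^^ n) [A]"

definition trib_prefix :: "letter list \<Rightarrow> bool" where
  "trib_prefix w \<longleftrightarrow> (\<exists>n. prefix w (trib n))"

text \<open>The words \<open>trib n\<close> extend one another and \<open>trib k\<close> has more
  than \<open>k\<close> letters, so position \<open>k\<close> exists and every later
  \<open>trib n\<close> agrees there.\<close>

definition T :: "nat \<Rightarrow> letter" where
  "T k = trib k ! k"

definition tp :: "nat \<Rightarrow> letter list" where
  "tp k = map T [0..<k]"

text \<open>The position where the block \<open>phi (T k)\<close> starts when \<open>T\<close> is
  cut into the images of its own letters.\<close>

definition L :: "nat \<Rightarrow> nat" where
  "L k = length (subst (tp k))"

lemma subst_simps [simp]:
  "subst [] = []" "subst (x # w) = phi x @ subst w" "subst (u @ v) = subst u @ subst v"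
  by (simp_all add: subst_def)

lemma nth_prefix: "prefix u v \<Longrightarrow> i < length u \<Longrightarrow> u ! i = v ! i"
  by (auto simp: prefix_def nth_append)

lemma prefix_subst: "prefix u v \<Longrightarrow> prefix (subst u) (subst v)"
  by (auto simp: prefix_def)

lemma trib_0: "trib 0 = [A]" and trib_Suc: "trib (Suc n) = subst (trib n)"
  by (simp_all add: trib_def)

lemma prefix_trib_Suc: "prefix (trib n) (trib (Suc n))"
  by (induction n) (auto simp: trib_0 trib_Suc intro: prefix_subst)

lemma prefix_trib: "m \<le> n \<Longrightarrow> prefix (trib m) (trib n)"
  by (induction rule: dec_induct) (auto intro: prefix_trib_Suc prefix_order.trans)

lemma length_subst_ge: "length w \<le> length (subst w)"
proof (induction w)
  case (Cons x w)
  then show ?case by (cases x) auto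
qed simp

lemma trib_eq_A_Cons: "\<exists>w. trib n = A # w"
proof (induction n)
  case (Suc n)
  then show ?case by (auto simp: trib_Suc)
qed (simp add: trib_0)

lemma length_trib: "n < length (trib n)"
proof (induction n)
  case (Suc n)
  obtain w where w: "trib n = A # w" using trib_eq_A_Cons by blast
  show ?case using Suc length_subst_ge[of w] by (simp add: trib_Suc w)
qed (simp add: trib_0)

lemma trib_prefix_iff: "trib_prefix w \<longleftrightarrow> w = tp (length w)"
proof
  assume "trib_prefix w"
  then obtain n where n: "prefix w (trib n)" by (auto simp: trib_prefix_def)
  have "w ! i = T i" if i: "i < length w" for i
  proof -
    define k where "k = max n i"
    have "prefix w (trib k)" "prefix (trib i) (trib k)"
      using n prefix_trib[of n k] prefix_trib[of i k] prefix_order.trans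
      by (auto simp: k_def)
    then show ?thesis
      using i length_trib[of i] by (simp add: T_def nth_prefix)
  qed
  then show "w = tp (length w)"
    by (auto intro!: nth_equalityI simp: tp_def)
next
  assume w: "w = tp (length w)"
  let ?n = "length w"
  have "w ! i = trib ?n ! i" if i: "i < ?n" for i
  proof -
    have "w ! i = T i" using i by (subst w) (simp add: tp_def)
    then show ?thesis
      using prefix_trib[of i ?n] i length_trib[of i]
      by (simp add: T_def nth_prefix)
  qed
  then have "w = take ?n (trib ?n)"
    using length_trib[of ?n] by (intro nth_equalityI) auto
  then show "trib_prefix w"
    unfolding trib_prefix_def by (metis take_is_prefix)
qed

lemma trib_prefix_subst: "trib_prefix w \<Longrightarrow> trib_prefix (subst w)"
  unfolding trib_prefix_def using prefix_subst trib_Suc by metis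

lemma trib_prefix_append: "trib_prefix (u @ v) \<Longrightarrow> trib_prefix u"
  unfolding trib_prefix_def using append_prefixD by blast

lemma length_tp [simp]: "length (tp k) = k"
  by (simp add: tp_def)

lemma trib_prefix_tp: "trib_prefix (tp k)"
  by (simp add: trib_prefix_iff)

lemma tp_0 [simp]: "tp 0 = []" and tp_Suc: "tp (Suc k) = tp k @ [T k]"
  by (simp_all add: tp_def)

section \<open>Blocks of the word and positions of its letters\<close>

lemma subst_tp: "subst (tp k) = tp (L k)"
  using trib_prefix_subst[OF trib_prefix_tp[of k]] by (simp add: trib_prefix_iff L_def)

lemma L_0 [simp]: "L 0 = 0" and L_Suc: "L (Suc k) = L k + length (phi (T k))"
  by (simp_all add: L_def tp_Suc)

lemma tp_L_add:
  assumes "j \<le> length (phi (T k))"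
  shows "tp (L k + j) = subst (tp k) @ take j (phi (T k))"
proof -
  have "trib_prefix (subst (tp (Suc k)))"
    by (intro trib_prefix_subst trib_prefix_tp)
  then have "trib_prefix ((subst (tp k) @ take j (phi (T k))) @ drop j (phi (T k)))"
    by (simp add: tp_Suc)
  then have "trib_prefix (subst (tp k) @ take j (phi (T k)))"
    by (rule trib_prefix_append)
  then show ?thesis
    using assms by (simp add: trib_prefix_iff L_def)
qed

lemma T_L_add:
  assumes "j < length (phi (T k))"
  shows "T (L k + j) = phi (T k) ! j"
proof -
  have "tp (L k + j) @ [T (L k + j)] = subst (tp k) @ take (Suc j) (phi (T k))"
    using tp_L_add[of "Suc j" k] assms by (simp add: tp_Suc)
  then show ?thesis
    using assms tp_L_add[of j k] by (simp add: take_Suc_conv_app_nth)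
qed

lemma T_L: "T (L k) = A"
  using T_L_add[of 0 k] by (cases "T k") auto

lemma block_decomposition: "\<exists>m j. k = L m + j \<and> j < length (phi (T m))"
proof (induction k)
  case 0
  show ?case by (rule exI[of _ 0], rule exI[of _ 0]) (cases "T 0", auto)
next
  case (Suc k)
  then obtain m j where mj: "k = L m + j" "j < length (phi (T m))" by blast
  show ?case
  proof (cases "Suc j < length (phi (T m))")
    case True
    then show ?thesis using mj by (metis add_Suc_right)
  next
    case False
    then have "Suc k = L (Suc m) + 0" using mj by (simp add: L_Suc)
    moreover have "0 < length (phi (T (Suc m)))" by (cases "T (Suc m)") auto
    ultimately show ?thesis by blast
  qed
qed

lemma T_eq_A_iff: "T k = A \<longleftrightarrow> k \<in> range L"
proof
  assume A: "T k = A"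
  obtain m j where mj: "k = L m + j" "j < length (phi (T m))"
    using block_decomposition by blast
  then have "j = 0" using A T_L_add[OF mj(2)]
    by (cases "T m"; cases j) auto
  then show "k \<in> range L" using mj by simp
qed (auto simp: T_L)

text \<open>The letter \<open>B\<close> arises only as the second letter of \<open>phi A\<close>,
  and by \<open>T_eq_A_iff\<close> the letters \<open>A\<close> stand exactly at the positions
  \<open>L j\<close>.\<close>

lemma T_eq_B_iff: "T k = B \<longleftrightarrow> k \<in> range (\<lambda>j. Suc (L (L j)))"
proof
  assume B: "T k = B"
  obtain m j where mj: "k = L m + j" "j < length (phi (T m))"
    using block_decomposition by blast
  then have "j = 1 \<and> T m = A" using B T_L_add[OF mj(2)]
    by (cases "T m"; cases j) auto
  then show "k \<in> range (\<lambda>j. Suc (L (L j)))" using mj by (auto simp: T_eq_A_iff)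
next
  assume "k \<in> range (\<lambda>j. Suc (L (L j)))"
  then obtain j where "k = L (L j) + 1" by auto
  then show "T k = B" using T_L_add[of 1 "L j"] by (simp add: T_L)
qed

section \<open>Letter counts in prefixes\<close>

definition cnt :: "letter \<Rightarrow> nat \<Rightarrow> nat" where
  "cnt x k = count_list (tp k) x"

lemma cnt_0 [simp]: "cnt x 0 = 0"
  and cnt_Suc: "cnt x (Suc k) = cnt x k + (if T k = x then 1 else 0)"
  by (simp_all add: cnt_def tp_Suc)

lemma count_list_subst:
  "count_list (subst w) A = length w"
  "count_list (subst w) B = count_list w A"
proof (induction w)
  case (Cons x w)
  { case 1 show ?case using Cons by (cases x) auto }
  { case 2 show ?case using Cons by (cases x) auto }
qed auto

lemma cnt_L: "cnt A (L k) = k" "cnt B (L k) = cnt A k"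
  by (simp_all add: cnt_def subst_tp[symmetric] count_list_subst)

lemma L_eq: "L k = k + cnt A k + cnt B k"
proof (induction k)
  case (Suc k)
  then show ?case by (cases "T k") (auto simp: L_Suc cnt_Suc)
qed simp

lemma less_L: "1 \<le> k \<Longrightarrow> k < L k"
proof (induction k rule: dec_induct)
  case base
  show ?case using T_L[of 0] by (simp add: L_Suc)
next
  case (step k)
  then show ?case by (cases "T k") (auto simp: L_Suc)
qed

section \<open>The greedy sequences\<close>

text \<open>Indices shift by one: \<open>xs k\<close> and \<open>ys k\<close> will be
  \<open>X (k + 1)\<close> and \<open>Y (k + 1)\<close>, with difference \<open>ds k\<close> and sum
  \<open>ss k\<close>.\<close>

definition xs :: "nat \<Rightarrow> nat" where "xs k = Suc k + cnt A k"
definition ds :: "nat \<Rightarrow> nat" where "ds k = Suc k + cnt B k"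
definition ys :: "nat \<Rightarrow> nat" where "ys k = xs k + ds k"
definition ss :: "nat \<Rightarrow> nat" where "ss k = xs k + ys k"

text \<open>The sequence \<open>f\<close> skips one value after each index in the range of
  \<open>h\<close>, and \<open>g\<close> lists the skipped values, so \<open>f\<close> and
  \<open>g\<close> together cover the positive integers without overlap. The last assumption yields
  that values below \<open>f n\<close> come from indices below \<open>n\<close>.\<close>

locale gap_pair =
  fixes f g h :: "nat \<Rightarrow> nat"
  assumes f_0: "f 0 = 1"
    and f_Suc: "\<And>k. f (Suc k) = f k + (if k \<in> range h then 2 else 1)"
    and g_eq: "\<And>j. g j = Suc (f (h j))"
    and f_less_g: "\<And>j. f j < g j"
begin

lemma strict_mono_f: "strict_mono f"
  by (simp add: strict_mono_Suc_iff f_Suc)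

lemma disjoint: "f i \<noteq> g j"
proof
  assume eq: "f i = g j"
  then have "f (h j) < f i" "f i < f (Suc (h j))"
    by (auto simp: g_eq f_Suc)
  then show False
    using strict_mono_less[OF strict_mono_f] by auto
qed

lemma cover:
  assumes "1 \<le> v"
  shows "\<exists>k. v = f k \<or> v = g k"
  using assms
proof (induction v rule: dec_induct)
  case base
  then show ?case using f_0 by metis
next
  case (step v)
  then consider k where "v = f k" | j where "v = g j" by blast
  then show ?case
  proof cases
    case 1
    then have "Suc v = f (Suc k) \<or> Suc v \<in> range g"
      by (cases "k \<in> range h") (auto simp: g_eq f_Suc)
    then show ?thesis by blast
  next
    case 2
    then have "Suc v = f (Suc (h j))" by (simp add: g_eq f_Suc)
    then show ?thesis by blast
  qed
qed

lemma cover_below: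
  assumes "1 \<le> v" "v < f n"
  shows "\<exists>k<n. v = f k \<or> v = g k"
proof -
  obtain k where k: "v = f k \<or> v = g k" using cover assms(1) by blast
  then have "f k < f n" using assms(2) f_less_g[of k] by auto
  then have "k < n" using strict_mono_less[OF strict_mono_f] by blast
  with k show ?thesis by blast
qed

end

interpretation xy: gap_pair xs ys L
proof
  show "xs (Suc k) = xs k + (if k \<in> range L then 2 else 1)" for k
    by (auto simp: xs_def cnt_Suc T_eq_A_iff)
  show "ys j = Suc (xs (L j))" for j
    unfolding xs_def ys_def ds_def cnt_L using L_eq[of j] by linarith
qed (auto simp: xs_def ys_def ds_def)

interpretation ds: gap_pair ds ss "\<lambda>j. Suc (L (L j))"
proof
  show "ds (Suc k) = ds k + (if k \<in> range (\<lambda>j. Suc (L (L j))) then 2 else 1)" for k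
    by (auto simp: ds_def cnt_Suc T_eq_B_iff)
  show "ss j = Suc (ds (Suc (L (L j))))" for j
    unfolding ss_def ys_def xs_def ds_def cnt_Suc T_L cnt_L
    using L_eq[of j] L_eq[of "L j", unfolded cnt_L] by simp
qed (auto simp: ss_def xs_def ys_def ds_def)

section \<open>The greedy choice\<close>

lemma good_iff:
  assumes "P = (\<lambda>k. (xs k, ys k)) ` K"
  shows "good P x y \<longleftrightarrow> 0 < x \<and> x < y \<and>
    (\<forall>k\<in>K. x \<noteq> xs k \<and> x \<noteq> ys k \<and> y \<noteq> xs k \<and> y \<noteq> ys k \<and> y - x \<noteq> ds k \<and> y - x \<noteq> ss k)"
proof -
  have "int y - int x = int (ys k) - int (xs k) \<longleftrightarrow> y - x = ds k"
    "int y - int x = int (ys k) + int (xs k) \<longleftrightarrow> y - x = ss k" if "x < y" for k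
    using that by (auto simp: ys_def ss_def)
  then show ?thesis
    unfolding good_def assms by (auto simp: image_image)
qed

lemma good_greedy:
  assumes "P = (\<lambda>k. (xs k, ys k)) ` {..<n}"
  shows "good P (xs n) (ys n)"
proof -
  have less: "xs k < xs n" "ds k < ds n" "ys k < ys n" if "k < n" for k
    using that strict_monoD[OF xy.strict_mono_f] strict_monoD[OF ds.strict_mono_f]
    by (auto simp: ys_def add_strict_mono)
  have "ys n - xs n = ds n" "0 < xs n" "xs n < ys n"
    by (auto simp: ys_def xs_def ds_def)
  then show ?thesis
    unfolding good_iff[OF assms]
    using less xy.disjoint ds.disjoint by (metis lessThan_iff nat_neq_iff)
qed

text \<open>By \<open>cover_below\<close>, every smaller positive candidate, first for
  \<open>x\<close> and then for \<open>y - x\<close>, is a term of index below \<open>n\<close> and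
  hence excluded.\<close>

lemma Least_good:
  assumes P: "P = (\<lambda>k. (xs k, ys k)) ` {..<n}"
  shows "(LEAST x. \<exists>y. good P x y) = xs n" "(LEAST y. good P (xs n) y) = ys n"
proof -
  show "(LEAST x. \<exists>y. good P x y) = xs n"
  proof (rule Least_equality)
    fix x assume "\<exists>y. good P x y"
    then have "1 \<le> x" "\<forall>k<n. x \<noteq> xs k \<and> x \<noteq> ys k"
      by (auto simp: good_iff[OF P])
    then show "xs n \<le> x" using xy.cover_below by (meson not_le)
  qed (use good_greedy[OF P] in blast)
  show "(LEAST y. good P (xs n) y) = ys n"
  proof (rule Least_equality)
    fix y assume "good P (xs n) y"
    then have "xs n < y" "1 \<le> y - xs n" "\<forall>k<n. y - xs n \<noteq> ds k \<and> y - xs n \<noteq> ss k"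
      by (auto simp: good_iff[OF P])
    moreover from this have "ds n \<le> y - xs n" using ds.cover_below by (meson not_le)
    ultimately show "ys n \<le> y" by (simp add: ys_def)
  qed (use good_greedy[OF P] in blast)
qed

lemma XY_Suc: "XY (Suc n) = (xs n, ys n)"
proof (induction n rule: less_induct)
  case (less n)
  show ?case
  proof (cases n)
    case 0
    then show ?thesis by (simp add: xs_def ys_def ds_def)
  next
    case (Suc m)
    have "XY ` {1..<Suc n} = (\<lambda>k. XY (Suc k)) ` {..<n}"
      by (metis (no_types) One_nat_def image_Suc_lessThan image_image atLeastLessThanSuc_atLeastAtMost)
    also have "\<dots> = (\<lambda>k. (xs k, ys k)) ` {..<n}"
      using less by (intro image_cong) auto
    finally have P: "XY ` {1..<Suc n} = (\<lambda>k. (xs k, ys k)) ` {..<n}" .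
    show ?thesis
      using Least_good[OF P] by (simp add: Suc Let_def)
  qed
qed

section \<open>Prefixes of length \<open>L k + k + 1\<close>\<close>

text \<open>
  The prefix of length \<^term>\<open>L k + k + 1\<close> turns out to be an anagram of
  \<^term>\<open>subst (tp k) @ tp k @ [l]\<close> for a letter \<open>l\<close>. A state consists of the next letter
  \<^term>\<open>T k\<close>, the letter \<open>l\<close>, and the window \<open>q\<close> of length 5 that starts two letters before the end
  of that prefix. Applying \<^const>\<open>subst\<close> to the window of \<open>m\<close> produces enough letters to read off the
  states of the one or two positions \<^term>\<open>L m + j\<close> of the image of \<^term>\<open>T m\<close>. The list was found by
  computing the states that occur for \<open>k \<ge> 1\<close>.
\<close>

definition states :: "(letter \<times> letter \<times> letter list) list" where
  "states =
    [(B, C, [A,C,A,B,A]), (A, A, [B,A,A,B,A]), (C, A, [B,A,C,A,B]), (A, A, [C,A,B,A,B]),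
     (B, B, [A,B,A,C,A]), (A, A, [C,A,B,A,A]), (A, A, [A,A,B,A,C]), (A, A, [B,A,C,A,B]),
     (C, C, [A,B,A,A,B]), (A, A, [B,A,B,A,C]), (B, A, [A,A,B,A,C]), (A, A, [A,C,A,B,A]),
     (A, A, [C,A,B,A,C]), (C, C, [A,C,A,B,A]), (A, B, [A,B,A,A,B]), (B, C, [A,B,A,B,A])]"

definition reaches :: "nat \<Rightarrow> bool" where
  "reaches k \<longleftrightarrow> (\<exists>l p q. (T k, l, q) \<in> set states \<and> trib_prefix (p @ q) \<and>
     mset (p @ take 2 q) = mset (subst (tp k) @ tp k @ [l]))"

text \<open>Here \<open>i\<close> is the start of the new window in \<open>subst q\<close>. The
  counts express the balance wanted at \<open>L m + j\<close> minus the image under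
  \<open>subst\<close> of the balance at \<open>m\<close>: the unbounded words \<open>p\<close> and
  \<open>tp m\<close> cancel, which leaves a finite check.\<close>

definition step_ok :: "letter \<Rightarrow> letter \<Rightarrow> letter list \<Rightarrow> nat \<Rightarrow> nat \<Rightarrow> letter \<Rightarrow> bool" where
  "step_ok x l q j i l' \<longleftrightarrow>
     (phi x ! j, l', take 5 (drop i (subst q))) \<in> set states \<and>
     list_all (\<lambda>z. count_list (take (i + 2) (subst q) @ phi l) z =
       count_list (subst (take 2 q) @ subst (take j (phi x)) @ take j (phi x) @ [l']) z) [A, B, C]"

text \<open>Since \<open>subst q\<close> has at most ten letters, a window of five starts at
  position 5 or earlier, so the bound 8 suffices.\<close>

lemma states_closed_check:
  "list_all (\<lambda>(x, l, q). list_all (\<lambda>j. list_ex (\<lambda>i. list_ex (step_ok x l q j i) [A, B, C])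
     [0..<8]) [0..<length (phi x)]) states"
  by code_simp

lemma states_closed:
  assumes "(x, l, q) \<in> set states" "j < length (phi x)"
  obtains i l' where "step_ok x l q j i l'"
  using states_closed_check assms by (fastforce simp: list_all_iff list_ex_iff)

lemma mset_subst_eq_sum: "mset (subst w) = (\<Sum>x\<in>#mset w. mset (phi x))"
  by (induction w) auto

lemma mset_subst_cong: "mset u = mset v \<Longrightarrow> mset (subst u) = mset (subst v)"
  by (simp add: mset_subst_eq_sum)

lemma step_okD:
  assumes "step_ok x l q j i l'"
  shows "(phi x ! j, l', take 5 (drop i (subst q))) \<in> set states"
    and "mset (take (i + 2) (subst q)) + mset (phi l) =
      mset (subst (take 2 q)) + mset (subst (take j (phi x))) + mset (take j (phi x)) + {#l'#}"
proof -
  show "(phi x ! j, l', take 5 (drop i (subst q))) \<in> set states"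
    using assms by (simp add: step_ok_def)
  have "count_list (take (i + 2) (subst q) @ phi l) z =
      count_list (subst (take 2 q) @ subst (take j (phi x)) @ take j (phi x) @ [l']) z" for z
    using assms by (cases z) (simp_all add: step_ok_def)
  then have "mset (take (i + 2) (subst q) @ phi l) =
      mset (subst (take 2 q) @ subst (take j (phi x)) @ take j (phi x) @ [l'])"
    by (simp add: multiset_eq_iff count_mset)
  then show "mset (take (i + 2) (subst q)) + mset (phi l) =
      mset (subst (take 2 q)) + mset (subst (take j (phi x))) + mset (take j (phi x)) + {#l'#}"
    by simp
qed

lemma add_eq_add_cancel:
  fixes p w :: "'a :: cancel_comm_monoid_add"
  assumes "p + s = a + f" "w + f = s + b"
  shows "p + w = a + b"
proof -
  have "(p + w) + (s + f) = (p + s) + (w + f)" by (simp only: ac_simps)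
  also have "\<dots> = (a + f) + (s + b)" by (simp only: assms)
  also have "\<dots> = (a + b) + (s + f)" by (simp only: ac_simps)
  finally show ?thesis by simp
qed

lemma reaches_step:
  assumes "reaches m" and j: "j < length (phi (T m))"
  shows "reaches (L m + j)"
proof -
  obtain l p q where st: "(T m, l, q) \<in> set states" and pq: "trib_prefix (p @ q)"
    and bal: "mset (p @ take 2 q) = mset (subst (tp m) @ tp m @ [l])"
    using assms(1) by (auto simp: reaches_def)
  obtain i l' where ok: "step_ok (T m) l q j i l'"
    using states_closed[OF st j] .
  let ?y = "take j (phi (T m))" and ?w = "subst q"
  let ?p = "subst p @ take i ?w" and ?q = "take 5 (drop i ?w)"
  have "trib_prefix ((?p @ ?q) @ drop 5 (drop i ?w))"
    using trib_prefix_subst[OF pq] by (simp only: append_assoc append_take_drop_id subst_simps)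
  then have "trib_prefix (?p @ ?q)" by (rule trib_prefix_append)
  moreover have "mset (?p @ take 2 ?q) = mset (subst (tp (L m + j)) @ tp (L m + j) @ [l'])"
  proof -
    have "take 2 ?q = take 2 (drop i ?w)" by simp
    then have "mset (?p @ take 2 ?q) = mset (subst p) + mset (take (i + 2) ?w)"
      by (simp only: take_add mset_append add.assoc)
    also have "\<dots> = mset (subst (subst (tp m))) + mset (subst (tp m)) +
        (mset (subst ?y) + mset ?y + {#l'#})"
    proof (rule add_eq_add_cancel)
      show "mset (subst p) + mset (subst (take 2 q)) =
          mset (subst (subst (tp m))) + mset (subst (tp m)) + mset (phi l)"
        using mset_subst_cong[OF bal] by simp
    qed (use step_okD(2)[OF ok] in \<open>simp only: add.assoc\<close>)
    also have "\<dots> = mset (subst (tp (L m + j)) @ tp (L m + j) @ [l'])"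
      using tp_L_add[of j m] j by (simp add: ac_simps)
    finally show ?thesis .
  qed
  ultimately show ?thesis
    using step_okD(1)[OF ok] T_L_add[OF j] unfolding reaches_def by metis
qed

text \<open>The induction cannot start at 0: there the prefix has only one letter, so no window
  starts two letters before its end.\<close>

lemma reaches_1: "reaches 1"
proof -
  have "trib_prefix ([A, B] @ [A, C, A, B, A])"
    unfolding trib_prefix_def
    by (rule exI[of _ 3]) (simp add: trib_def numeral_3_eq_3)
  moreover have "T 0 = A" "T 1 = B"
    by (simp_all add: T_def trib_def)
  ultimately show ?thesis
    unfolding reaches_def
    by (intro exI[of _ C] exI[of _ "[A, B]"] exI[of _ "[A, C, A, B, A]"])
      (simp add: states_def tp_Suc)
qed

lemma reaches_pos: "1 \<le> k \<Longrightarrow> reaches k"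
proof (induction k rule: less_induct)
  case (less k)
  obtain m j where mj: "k = L m + j" "j < length (phi (T m))"
    using block_decomposition by blast
  have T0: "T 0 = A" using T_L[of 0] by simp
  show ?case
  proof (cases "m = 0")
    case True
    \<comment> \<open>The first block is \<open>phi A\<close>, which occupies positions 0 and
      1.\<close>
    then have "k = 1" using mj less.prems T0 by simp
    then show ?thesis using reaches_1 by simp
  next
    case False
    then have "m < L m" using less_L by simp
    then have "reaches m" using less.IH[of m] mj False by simp
    then show ?thesis using reaches_step mj by simp
  qed
qed

lemma cnt_A_cases: "cnt A (L k + k + 1) \<in> {k + cnt A k, k + cnt A k + 1}"
proof (cases "k = 0")
  case True
  then show ?thesis using T_L[of 0] by (simp add: cnt_Suc)
next
  case False
  then obtain l p q where pq: "trib_prefix (p @ q)"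
    and bal: "mset (p @ take 2 q) = mset (subst (tp k) @ tp k @ [l])"
    using reaches_pos[of k] by (auto simp: reaches_def)
  have "length (p @ take 2 q) = L k + k + 1"
    using arg_cong[OF bal, of size] by (simp add: L_def)
  moreover have "trib_prefix (p @ take 2 q)"
    using pq trib_prefix_append[of "p @ take 2 q" "drop 2 q"] by simp
  ultimately have "tp (L k + k + 1) = p @ take 2 q"
    by (simp add: trib_prefix_iff)
  then have "cnt A (L k + k + 1) = count (mset (p @ take 2 q)) A"
    by (simp only: cnt_def count_mset)
  \<comment> \<open>Each of the \<open>k\<close> images in \<open>subst (tp k)\<close> contains
    \<open>A\<close> once; only the extra letter \<open>l\<close> is undetermined.\<close>
  also have "\<dots> = k + cnt A k + (if l = A then 1 else 0)"
    unfolding bal by (simp add: count_mset count_list_subst cnt_def)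
  finally show ?thesis by simp
qed

theorem mainTheorem1:
  fixes n :: nat
  assumes "n \<ge> 1"
  shows "X (Y n) = X n + Y n \<or> X (Y n) = X n + Y n - 1"
proof -
  obtain k where n: "n = Suc k" using assms by (cases n) auto
  have Y: "Y n = Suc (L k + k + 1)"
    using L_eq[of k] by (simp add: Y_def n XY_Suc ys_def xs_def ds_def)
  have "X (Y n) = xs (L k + k + 1)"
    by (simp only: X_def Y XY_Suc fst_conv)
  then have "X (Y n) = Y n + cnt A (L k + k + 1)"
    by (simp add: Y xs_def)
  moreover have "X n = Suc k + cnt A k"
    by (simp add: X_def n XY_Suc xs_def)
  ultimately show ?thesis using cnt_A_cases[of k] by auto
qed

end
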